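(* Let $k\ge 1$ be an integer. Let $G_L$ be an $\ell$-$LP_0$-snark with $\sigma\ge1$ link-vertices, where $\ell\ge 3$ is odd. Then $i_{[kR]}(G_L)\le 2(k+1)\ell+(k-1)\sigma$.
   Context: A basic block $B_i$ has vertices $p_i,q_i,r_i,s_i,t_i,u_i,v_i$ and edges $p_it_i,t_iq_i,q_ir_i,r_is_i,s_ip_i,u_iv_i,u_ip_i,v_iq_i$. For odd $\ell\ge3$, an $\ell$-$LP_1$-snark is built from disjoint blocks $B_0,\ldots,B_{\ell-1}$: for each $i\in\{0,\ldots,\ell-1\}$ (indices modulo $\ell$) add either the pair of edges $\{s_ir_{i+1},v_iu_{i+1}\}$ or the pair $\{s_iu_{i+1},v_ir_{i+1}\}$; then choose an odd number $\sigma$ with $1\le\sigma\le\lfloor\ell/3\rfloor$ of pairwise disjoint triples $\{t_i,t_j,t_s\}$ and for each add a new vertex (link-vertex) adjacent to its three vertices; finally, the remaining $\ell-3\sigma$ vertices $t_i$ are paired up and each pair is joined by an edge (repairing edge). An $\ell$-$LP_0$-snark is an $\ell$-$LP_1$-snark in which every link-vertex is adjacent to $t_i,t_{i+1},t_{i+2}$ for some $i$ and every repairing edge is of the form $t_it_{i+1}$ (indices modulo $\ell$). For $f\colon V(G)\to\mathbb{Z}_{\ge 0}$ and $S\subseteq V(G)$, $f(S)=\sum_{v\in S}f(v)$, and $AN(v)=\{w\in N(v): f(w)\ge 1\}$. A $[k]$-Roman dominating function of $G$ is a function $f\colon V(G)\to\{0,1,\ldots,k+1\}$ such that $f(N[v])\ge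 k+|AN(v)|$ for every vertex $v$ with $f(v)<k$; its weight is $f(V(G))$. $i_{[kR]}(G)$ is the minimum weight of such a function whose set of vertices with positive label is independent. *)

theory Defs
  imports "HOL-Library.Disjoint_Sets"
begin

record 'a ugraph =
  verts :: "'a set"
  edges :: "'a set set"

definition simple_graph :: "'a ugraph \<Rightarrow> bool" where
  "simple_graph G \<longleftrightarrow> finite (verts G) \<and> (\<forall>e\<in>edges G. e \<subseteq> verts G \<and> card e = 2)"

definition ugraph_iso :: "('a \<Rightarrow> 'b) \<Rightarrow> 'a ugraph \<Rightarrow> 'b ugraph \<Rightarrow> bool" where
  "ugraph_iso \<phi> G H \<longleftrightarrow> bij_betw \<phi> (verts G) (verts H) \<and> edges H = (\<lambda>e. \<phi> ` e) ` edges G"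

definition nbh :: "'a ugraph \<Rightarrow> 'a \<Rightarrow> 'a set" where
  "nbh G v = {w \<in> verts G. {v, w} \<in> edges G}"

definition closed_nbh :: "'a ugraph \<Rightarrow> 'a \<Rightarrow> 'a set" where
  "closed_nbh G v = insert v (nbh G v)"

definition independent_set :: "'a ugraph \<Rightarrow> 'a set \<Rightarrow> bool" where
  "independent_set G S \<longleftrightarrow> S \<subseteq> verts G \<and> (\<forall>x\<in>S. \<forall>y\<in>S. {x, y} \<notin> edges G)"

definition active_nbh :: "'a ugraph \<Rightarrow> ('a \<Rightarrow> nat) \<Rightarrow> 'a \<Rightarrow> 'a set" where
  "active_nbh G f v = {w \<in> nbh G v. f w \<ge> 1}"

text \<open>Labellings are total functions; only their values on the vertex set matter.\<close>

definition roman_dom_fun :: "nat \<Rightarrow> 'a ugraph \<Rightarrow> ('a \<Rightarrow> nat) \<Rightarrow> bool" where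
  "roman_dom_fun k G f \<longleftrightarrow>
     (\<forall>v\<in>verts G. f v \<le> k + 1) \<and>
     (\<forall>v\<in>verts G. f v < k \<longrightarrow> sum f (closed_nbh G v) \<ge> k + card (active_nbh G f v))"

definition indep_roman_dom_fun :: "nat \<Rightarrow> 'a ugraph \<Rightarrow> ('a \<Rightarrow> nat) \<Rightarrow> bool" where
  "indep_roman_dom_fun k G f \<longleftrightarrow>
     roman_dom_fun k G f \<and> independent_set G {v \<in> verts G. f v > 0}"

definition weight :: "'a ugraph \<Rightarrow> ('a \<Rightarrow> nat) \<Rightarrow> nat" where
  "weight G f = sum f (verts G)"

definition indep_roman_dom_number :: "nat \<Rightarrow> 'a ugraph \<Rightarrow> nat" where
  "indep_roman_dom_number k G = (LEAST w. \<exists>f. indep_roman_dom_fun k G f \<and> weight G f = w)"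

text \<open>The set over which the minimum is taken is nonempty: label a maximal independent
  set with \<open>k + 1\<close>.\<close>

lemma indep_roman_dom_fun_exists:
  assumes "simple_graph G"
  shows "\<exists>f. indep_roman_dom_fun k G f"
proof -
  have fin: "finite (verts G)" and loopfree: "{x, x} \<notin> edges G" for x
    using assms by (fastforce simp: simple_graph_def)+
  let ?I = "{S. independent_set G S}"
  have "?I \<subseteq> Pow (verts G)" by (auto simp: independent_set_def)
  hence "finite ?I" using fin by (meson finite_Pow_iff finite_subset)
  moreover have "{} \<in> ?I" by (simp add: independent_set_def)
  ultimately obtain S where S: "independent_set G S"
    and max: "\<And>T. independent_set G T \<Longrightarrow> S \<subseteq> T \<Longrightarrow> T = S"
    using finite_has_maximal2[of ?I "{}"] by auto
  define f where "f v = (if v \<in> S then k + 1 else 0)" for v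
  have SV: "S \<subseteq> verts G" using S by (simp add: independent_set_def)
  have pos: "{v \<in> verts G. f v > 0} = S" using SV by (auto simp: f_def)
  have "sum f (closed_nbh G v) \<ge> k + card (active_nbh G f v)"
    if v: "v \<in> verts G" "f v < k" for v
  proof -
    have vS: "v \<notin> S" using v by (auto simp: f_def)
    hence "\<not> independent_set G (insert v S)" using max[of "insert v S"] by auto
    then obtain w where w: "w \<in> S" "{v, w} \<in> edges G"
      using S v(1) loopfree by (auto simp: independent_set_def insert_commute)
    let ?A = "active_nbh G f v"
    have finN: "finite (closed_nbh G v)" using fin by (simp add: closed_nbh_def nbh_def)
    have A: "?A = nbh G v \<inter> S" by (auto simp: active_nbh_def f_def)
    have finA: "finite ?A" using fin by (simp add: active_nbh_def nbh_def)
    have "w \<in> ?A" using w SV by (auto simp: A nbh_def)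
    hence c: "card ?A \<ge> 1" using finA by (metis One_nat_def Suc_leI card_gt_0_iff empty_iff)
    have "k + card ?A \<le> (k + 1) * card ?A"
      using c by (cases "card ?A") auto
    also have "\<dots> = sum f ?A" by (simp add: A f_def)
    also have "\<dots> \<le> sum f (closed_nbh G v)"
      by (rule sum_mono2) (use finN in \<open>auto simp: active_nbh_def closed_nbh_def\<close>)
    finally show ?thesis .
  qed
  hence "roman_dom_fun k G f" by (auto simp: roman_dom_fun_def f_def)
  thus ?thesis using S pos by (auto simp: indep_roman_dom_fun_def)
qed

datatype snark_vertex =
    P nat | Q nat | R nat | S nat | T nat | U nat | V nat
  | Link "nat set"

text \<open>Link-vertices are named by the triple of block indices they join.\<close>

definition block_verts :: "nat \<Rightarrow> snark_vertex set" where
  "block_verts i = {P i, Q i, R i, S i, T i, U i, V i}"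

definition block_edges :: "nat \<Rightarrow> snark_vertex set set" where
  "block_edges i =
     {{P i, T i}, {T i, Q i}, {Q i, R i}, {R i, S i}, {S i, P i},
      {U i, V i}, {U i, P i}, {V i, Q i}}"

definition connecting_edges :: "nat \<Rightarrow> (nat \<Rightarrow> bool) \<Rightarrow> nat \<Rightarrow> snark_vertex set set" where
  "connecting_edges l c i =
     (let j = (i + 1) mod l in
      if c i then {{S i, R j}, {V i, U j}} else {{S i, U j}, {V i, R j}})"

definition link_edges :: "nat set \<Rightarrow> snark_vertex set set" where
  "link_edges t = (\<lambda>i. {Link t, T i}) ` t"

definition snark_graph ::
    "nat \<Rightarrow> (nat \<Rightarrow> bool) \<Rightarrow> nat set set \<Rightarrow> nat set set \<Rightarrow> snark_vertex ugraph" where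
  "snark_graph l c Ts Ps =
     \<lparr> verts = (\<Union>i<l. block_verts i) \<union> Link ` Ts,
       edges = (\<Union>i<l. block_edges i \<union> connecting_edges l c i)
               \<union> (\<Union>t\<in>Ts. link_edges t)
               \<union> (\<lambda>p. T ` p) ` Ps \<rparr>"

text \<open>\<open>Ts\<close> are the triples joined by link-vertices, \<open>Ps\<close> the pairs joined by repairing
  edges, both as sets of block indices; \<open>card Ts\<close> is \<open>\<sigma>\<close>.\<close>

definition LP1_data :: "nat \<Rightarrow> nat set set \<Rightarrow> nat set set \<Rightarrow> bool" where
  "LP1_data l Ts Ps \<longleftrightarrow>
     odd l \<and> l \<ge> 3 \<and>
     (\<forall>t\<in>Ts. t \<subseteq> {..<l} \<and> card t = 3) \<and> disjoint Ts \<and>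
     odd (card Ts) \<and> 1 \<le> card Ts \<and> card Ts \<le> l div 3 \<and>
     (\<forall>p\<in>Ps. card p = 2) \<and> partition_on ({..<l} - \<Union>Ts) Ps"

definition LP0_data :: "nat \<Rightarrow> nat set set \<Rightarrow> nat set set \<Rightarrow> bool" where
  "LP0_data l Ts Ps \<longleftrightarrow>
     LP1_data l Ts Ps \<and>
     (\<forall>t\<in>Ts. \<exists>i<l. t = {i, (i + 1) mod l, (i + 2) mod l}) \<and>
     (\<forall>p\<in>Ps. \<exists>i<l. p = {i, (i + 1) mod l})"

text \<open>Snarks are taken up to isomorphism; the second argument is the number of link-vertices.\<close>

definition LP1_snark :: "nat \<Rightarrow> nat \<Rightarrow> 'a ugraph \<Rightarrow> bool" where
  "LP1_snark l s G \<longleftrightarrow>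
     (\<exists>c Ts Ps \<phi>. LP1_data l Ts Ps \<and> card Ts = s \<and> ugraph_iso \<phi> (snark_graph l c Ts Ps) G)"

definition LP0_snark :: "nat \<Rightarrow> nat \<Rightarrow> 'a ugraph \<Rightarrow> bool" where
  "LP0_snark l s G \<longleftrightarrow>
     (\<exists>c Ts Ps \<phi>. LP0_data l Ts Ps \<and> card Ts = s \<and> ugraph_iso \<phi> (snark_graph l c Ts Ps) G)"

lemma LP0_snark_imp_LP1_snark: "LP0_snark l s G \<Longrightarrow> LP1_snark l s G"
  unfolding LP0_snark_def LP1_snark_def LP0_data_def by blast

end

theory Submission
  imports Defs
begin

text \<open>Label \<open>P i\<close> and \<open>Q i\<close> with \<open>k + 1\<close> in every block. This dominates everything except the
  link-vertices, and labelling those with \<open>k\<close> would cost \<open>\<sigma>\<close> too much. So on every linked triple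
  \<open>i, i + 1, i + 2\<close> the labels are rearranged: the link-vertex, the exits \<open>S i, V i\<close> of the first
  block and the entrances \<open>R (i + 2), U (i + 2)\<close> of the last one get \<open>k + 1\<close>. These dominate
  all of the triple but \<open>P (i + 1)\<close> and \<open>Q (i + 1)\<close>, whichever connecting edges were chosen, and those
  two get the self-sufficient label \<open>k\<close>. A triple then costs \<open>5 (k + 1) + 2 k = 6 (k + 1) + (k - 1)\<close>.\<close>

section \<open>Roman domination and graph isomorphisms\<close>

text \<open>One neighbour labelled \<open>k + 1\<close> suffices: it supplies \<open>k\<close> and
  the 1 by which it raises the count, and every other active neighbour, with label at least 1, pays
  for itself.\<close>

lemma roman_dom_funI:
  assumes "finite (verts G)"
    and le: "\<And>v. v \<in> verts G \<Longrightarrow> f v \<le> k + 1"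
    and dom: "\<And>v. v \<in> verts G \<Longrightarrow> f v < k \<Longrightarrow> \<exists>w\<in>nbh G v. f w = k + 1"
  shows "roman_dom_fun k G f"
  unfolding roman_dom_fun_def
proof (intro conjI ballI impI)
  fix v assume v: "v \<in> verts G" "f v < k"
  obtain w where w: "w \<in> nbh G v" "f w = k + 1" using dom[OF v] by blast
  let ?A = "active_nbh G f v"
  have fin: "finite (closed_nbh G v)" "finite ?A"
    using assms(1) by (simp_all add: closed_nbh_def active_nbh_def nbh_def)
  have wA: "w \<in> ?A" using w by (simp add: active_nbh_def)
  have "card (?A - {w}) \<le> sum f (?A - {w})"
    using sum_mono[of "?A - {w}" "\<lambda>_. 1" f] by (simp add: active_nbh_def)
  moreover have "sum f ?A = f w + sum f (?A - {w})" "card ?A = Suc (card (?A - {w}))"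
    using sum.remove[OF fin(2) wA, of f] card.remove[OF fin(2) wA] by simp_all
  moreover have "sum f ?A \<le> sum f (closed_nbh G v)"
    by (rule sum_mono2) (use fin in \<open>auto simp: active_nbh_def closed_nbh_def\<close>)
  ultimately show "k + card ?A \<le> sum f (closed_nbh G v)" using w(2) by linarith
qed (use le in auto)

text \<open>\<open>\<phi>\<close> is injective on \<open>verts H\<close> only, so edges have to stay
  inside that set to be recoverable from their images.\<close>

lemma ugraph_iso_edge_iff:
  assumes iso: "ugraph_iso \<phi> H G" and sub: "\<And>e. e \<in> edges H \<Longrightarrow> e \<subseteq> verts H"
    and "v \<in> verts H" "w \<in> verts H"
  shows "{\<phi> v, \<phi> w} \<in> edges G \<longleftrightarrow> {v, w} \<in> edges H"
proof
  have inj: "inj_on \<phi> (verts H)" and E: "edges G = (\<lambda>e. \<phi> ` e) ` edges H"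
    using iso by (auto simp: ugraph_iso_def bij_betw_def)
  show "{v, w} \<in> edges H" if vw: "{\<phi> v, \<phi> w} \<in> edges G"
  proof -
    obtain e where e: "e \<in> edges H" "\<phi> ` {v, w} = \<phi> ` e" using vw E by auto
    hence "{v, w} = e"
      using inj_on_image_eq_iff[OF inj, of "{v, w}" e] sub assms(3,4) by auto
    thus ?thesis using e by simp
  qed
  show "{\<phi> v, \<phi> w} \<in> edges G" if "{v, w} \<in> edges H"
    using imageI[OF that, of "\<lambda>e. \<phi> ` e"] E by simp
qed

text \<open>Snarks are given up to isomorphism; this lets a labelling be built and weighed on the
  concrete \<open>snark_graph\<close>.\<close>

lemma indep_roman_dom_number_le_iso:
  assumes iso: "ugraph_iso \<phi> H G" and sub: "\<And>e. e \<in> edges H \<Longrightarrow> e \<subseteq> verts H"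
    and f: "indep_roman_dom_fun k H f"
  shows "indep_roman_dom_number k G \<le> weight H f"
proof -
  have inj: "inj_on \<phi> (verts H)" and im: "verts G = \<phi> ` verts H"
    using iso by (auto simp: ugraph_iso_def bij_betw_def)
  note edge = ugraph_iso_edge_iff[OF iso sub]
  define g where "g = f \<circ> inv_into (verts H) \<phi>"
  have g: "g (\<phi> v) = f v" if "v \<in> verts H" for v using inj that by (simp add: g_def)
  have sum_g: "sum g (\<phi> ` A) = sum f A" if "A \<subseteq> verts H" for A
    using that inj g by (subst sum.reindex) (auto intro!: sum.cong intro: inj_on_subset)
  have nbh: "nbh G (\<phi> v) = \<phi> ` nbh H v" if "v \<in> verts H" for v
    using that by (auto simp: nbh_def im edge)
  have "roman_dom_fun k G g"
    unfolding roman_dom_fun_def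
  proof (intro conjI ballI impI)
    fix x assume "x \<in> verts G"
    then obtain v where v: "v \<in> verts H" "x = \<phi> v" using im by auto
    show "g x \<le> k + 1" using f v g by (auto simp: indep_roman_dom_fun_def roman_dom_fun_def)
    assume "g x < k"
    hence "k + card (active_nbh H f v) \<le> sum f (closed_nbh H v)"
      using f v g by (auto simp: indep_roman_dom_fun_def roman_dom_fun_def)
    moreover have "active_nbh G g x = \<phi> ` active_nbh H f v"
      using v nbh[of v] g by (auto simp: active_nbh_def nbh_def)
    moreover have "active_nbh H f v \<subseteq> verts H" by (auto simp: active_nbh_def nbh_def)
    moreover have "closed_nbh G x = \<phi> ` closed_nbh H v" using v nbh by (simp add: closed_nbh_def)
    moreover have "closed_nbh H v \<subseteq> verts H" using v by (auto simp: closed_nbh_def nbh_def)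
    ultimately show "k + card (active_nbh G g x) \<le> sum g (closed_nbh G x)"
      using sum_g inj by (simp add: card_image inj_on_subset)
  qed
  moreover have "independent_set G {v \<in> verts G. g v > 0}"
    using f g edge by (auto simp: indep_roman_dom_fun_def independent_set_def im)
  moreover have "weight G g = weight H f" using sum_g by (simp add: weight_def im)
  ultimately show ?thesis
    unfolding indep_roman_dom_number_def indep_roman_dom_fun_def by (intro Least_le) auto
qed

text \<open>Keeps only what both choices of connecting pair share: an exit of block \<open>i\<close>
  meets an entrance of the next block.\<close>

lemma connecting_edges_cases:
  assumes "e \<in> connecting_edges l c i"
  obtains v w where "e = {v, w}" "v \<in> {S i, V i}" "w \<in> {R ((i + 1) mod l), U ((i + 1) mod l)}"
  using assms by (auto simp: connecting_edges_def Let_def split: if_splits)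

lemma snark_graph_edge_subset:
  assumes "LP1_data l Ts Ps" "e \<in> edges (snark_graph l c Ts Ps)"
  shows "e \<subseteq> verts (snark_graph l c Ts Ps)"
proof -
  have l: "l > 0" using assms(1) by (auto simp: LP1_data_def)
  have Ts: "t \<subseteq> {..<l}" if "t \<in> Ts" for t using assms(1) that by (simp add: LP1_data_def)
  have Ps: "p \<subseteq> {..<l}" if "p \<in> Ps" for p
    using assms(1) that by (auto simp: LP1_data_def partition_on_def)
  consider (block) i where "i < l" "e \<in> block_edges i"
    | (conn) i where "i < l" "e \<in> connecting_edges l c i"
    | (link) t where "t \<in> Ts" "e \<in> link_edges t"
    | (repair) p where "p \<in> Ps" "e = T ` p"
    using assms(2) by (auto simp: snark_graph_def)
  thus ?thesis
  proof cases
    case block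
    hence "e \<subseteq> block_verts i" by (auto simp: block_edges_def block_verts_def)
    thus ?thesis using block by (auto simp: snark_graph_def)
  next
    case conn
    have "e \<subseteq> block_verts i \<union> block_verts ((i + 1) mod l)"
      by (rule connecting_edges_cases[OF conn(2)]) (auto simp: block_verts_def)
    moreover have "(i + 1) mod l < l" using l by simp
    ultimately show ?thesis using conn(1) by (fastforce simp: snark_graph_def)
  next
    case link
    thus ?thesis using Ts by (fastforce simp: snark_graph_def link_edges_def block_verts_def)
  next
    case repair
    thus ?thesis using Ps by (fastforce simp: snark_graph_def block_verts_def)
  qed
qed

section \<open>The labelling: domination, independence, weight\<close>

text \<open>\<open>X\<close>, \<open>M\<close> and \<open>Z\<close> stand for the sets of first,
  middle and last indices of the linked triples.\<close>

fun triple_label :: "nat \<Rightarrow> nat set \<Rightarrow> nat set \<Rightarrow> nat set \<Rightarrow> snark_vertex \<Rightarrow> nat" where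
  "triple_label k X M Z (P i) = (if i \<in> M then k else if i \<in> X \<union> Z then 0 else k + 1)"
| "triple_label k X M Z (Q i) = (if i \<in> M then k else if i \<in> X \<union> Z then 0 else k + 1)"
| "triple_label k X M Z (S i) = (if i \<in> X then k + 1 else 0)"
| "triple_label k X M Z (V i) = (if i \<in> X then k + 1 else 0)"
| "triple_label k X M Z (R i) = (if i \<in> Z then k + 1 else 0)"
| "triple_label k X M Z (U i) = (if i \<in> Z then k + 1 else 0)"
| "triple_label k X M Z (T i) = 0"
| "triple_label k X M Z (Link t) = k + 1"

text \<open>The equation for \<open>M\<close> serves twice: every middle block has a predecessor in
  \<open>X\<close> whose exits dominate its entrances, and successors of \<open>X\<close> avoid
  \<open>Z\<close>, so no connecting edge joins two positive labels.\<close>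

lemma triple_label_indep_roman_dom_fun:
  assumes "k \<ge> 1" and data: "LP1_data l Ts Ps"
    and disj: "X \<inter> M = {}" "X \<inter> Z = {}" "M \<inter> Z = {}"
    and linked: "X \<union> M \<union> Z = \<Union>Ts"
    and M: "M = (\<lambda>i. (i + 1) mod l) ` X"
    and Z: "\<And>i. i \<in> M \<Longrightarrow> (i + 1) mod l \<in> Z"
  shows "indep_roman_dom_fun k (snark_graph l c Ts Ps) (triple_label k X M Z)"
proof -
  let ?G = "snark_graph l c Ts Ps" and ?f = "triple_label k X M Z"
  have l: "l > 0" using data by (auto simp: LP1_data_def)
  have Ts: "t \<subseteq> {..<l}" if "t \<in> Ts" for t using data that by (simp add: LP1_data_def)
  have lt: "i < l" if "i \<in> X \<union> M \<union> Z" for i using that linked Ts by auto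
  have "finite Ts" using data by (intro card_ge_0_finite) (simp add: LP1_data_def)
  hence fin: "finite (verts ?G)" by (simp add: snark_graph_def block_verts_def)
  have nbh_block: "w \<in> nbh ?G v" if "{v, w} \<in> block_edges i" "w \<in> block_verts i" "i < l" for v w i
    using that by (auto simp: nbh_def snark_graph_def)
  have nbh_P: "P i \<in> nbh ?G (S i)" "P i \<in> nbh ?G (U i)" "P i \<in> nbh ?G (T i)"
    and nbh_Q: "Q i \<in> nbh ?G (R i)" "Q i \<in> nbh ?G (V i)"
    and nbh_S: "S i \<in> nbh ?G (P i)" "S i \<in> nbh ?G (R i)"
    and nbh_V: "V i \<in> nbh ?G (Q i)" "V i \<in> nbh ?G (U i)"
    and nbh_R: "R i \<in> nbh ?G (Q i)" "R i \<in> nbh ?G (S i)"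
    and nbh_U: "U i \<in> nbh ?G (P i)" "U i \<in> nbh ?G (V i)" if "i < l" for i
    by (rule nbh_block[OF _ _ that]; simp add: block_edges_def block_verts_def doubleton_eq_iff)+
  \<comment> \<open>Which entrance is adjacent depends on \<open>c i\<close>, but the disjunction is
    enough, since both entrances of a block carry the same label. The same goes for exits in
    \<open>nbh_prev\<close>.\<close>
  have nbh_next: "R ((i + 1) mod l) \<in> nbh ?G v \<or> U ((i + 1) mod l) \<in> nbh ?G v"
    if "i < l" "v \<in> {S i, V i}" for v i
  proof -
    have "{v, R ((i + 1) mod l)} \<in> connecting_edges l c i
        \<or> {v, U ((i + 1) mod l)} \<in> connecting_edges l c i"
      using that by (auto simp: connecting_edges_def Let_def)
    thus ?thesis using that(1) l by (fastforce simp: nbh_def snark_graph_def block_verts_def)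
  qed
  have nbh_prev: "S i \<in> nbh ?G v \<or> V i \<in> nbh ?G v"
    if "i < l" "v \<in> {R ((i + 1) mod l), U ((i + 1) mod l)}" for v i
  proof -
    have "{v, S i} \<in> connecting_edges l c i \<or> {v, V i} \<in> connecting_edges l c i"
      using that by (auto simp: connecting_edges_def Let_def insert_commute)
    thus ?thesis using that(1) by (fastforce simp: nbh_def snark_graph_def block_verts_def)
  qed
  have link: "\<exists>w\<in>nbh ?G (T i). ?f w = k + 1" if i: "i \<in> X \<union> M \<union> Z" for i
  proof -
    obtain t where t: "t \<in> Ts" "i \<in> t" using i linked by auto
    hence "{T i, Link t} \<in> link_edges t" by (auto simp: link_edges_def)
    hence "Link t \<in> nbh ?G (T i)" using t by (auto simp: nbh_def snark_graph_def)
    thus ?thesis by force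
  qed
  have dom: "\<exists>w\<in>nbh ?G v. ?f w = k + 1" if v: "v \<in> block_verts i" "i < l" "?f v < k" for v i
  proof -
    consider "i \<in> X" | "i \<in> M" | "i \<in> Z" | "i \<notin> X \<union> M \<union> Z" by blast
    thus ?thesis
    proof cases
      case 1
      have "?f (S i) = k + 1" "?f (V i) = k + 1" using 1 by simp_all
      moreover have "v \<in> {P i, Q i, R i, U i, T i}" using v 1 by (auto simp: block_verts_def)
      ultimately show ?thesis using link[of i] 1 nbh_S[OF v(2)] nbh_V[OF v(2)] by blast
    next
      case 2
      obtain j where j: "j \<in> X" "i = (j + 1) mod l" using 2 M by auto
      have "?f (S j) = k + 1" "?f (V j) = k + 1" using j by simp_all
      moreover have "?f (R ((i + 1) mod l)) = k + 1" "?f (U ((i + 1) mod l)) = k + 1"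
        using Z[OF 2] by simp_all
      \<comment> \<open>\<open>P i\<close> and \<open>Q i\<close> are absent: their label
        \<open>k\<close> is exempt from the domination condition.\<close>
      moreover have "v \<in> {S i, V i} \<or> v \<in> {R i, U i} \<or> v = T i"
        using v 2 by (auto simp: block_verts_def)
      ultimately show ?thesis using link[of i] 2 nbh_next[OF v(2), of v] nbh_prev[of j v] j lt[of j]
        by blast
    next
      case 3
      have "?f (R i) = k + 1" "?f (U i) = k + 1" using 3 by simp_all
      moreover have "v \<in> {P i, Q i, S i, V i, T i}" using v 3 by (auto simp: block_verts_def)
      ultimately show ?thesis using link[of i] 3 nbh_R[OF v(2)] nbh_U[OF v(2)] by blast
    next
      case 4
      hence "?f (P i) = k + 1" "?f (Q i) = k + 1" by simp_all
      moreover have "v \<in> {S i, U i, T i, R i, V i}" using v 4 by (auto simp: block_verts_def)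
      ultimately show ?thesis using nbh_P[OF v(2)] nbh_Q[OF v(2)] by blast
    qed
  qed
  have "roman_dom_fun k ?G ?f"
  proof (rule roman_dom_funI[OF fin])
    fix v assume v: "v \<in> verts ?G"
    show "?f v \<le> k + 1" by (cases v) auto
    assume "?f v < k"
    with v obtain i where "i < l" "v \<in> block_verts i" by (auto simp: snark_graph_def)
    thus "\<exists>w\<in>nbh ?G v. ?f w = k + 1" using dom \<open>?f v < k\<close> by blast
  qed
  \<comment> \<open>Independence of the positive labels, edge by edge.\<close>
  moreover have "\<exists>v\<in>e. ?f v = 0" if e: "e \<in> edges ?G" for e
  proof -
    consider (block) i where "i < l" "e \<in> block_edges i"
      | (conn) i where "i < l" "e \<in> connecting_edges l c i"
      | (link) t where "t \<in> Ts" "e \<in> link_edges t"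
      | (repair) p where "p \<in> Ps" "e = T ` p"
      using e by (auto simp: snark_graph_def)
    thus ?thesis
    proof cases
      case block
      thus ?thesis using disj by (auto simp: block_edges_def)
    next
      case conn
      \<comment> \<open>A labelled exit leads to a middle block, whose entrances have label
        0.\<close>
      have "(i + 1) mod l \<notin> Z" if "i \<in> X" using that M disj by blast
      with conn(2) show ?thesis by (elim connecting_edges_cases) auto
    next
      case link
      thus ?thesis by (auto simp: link_edges_def)
    next
      case repair
      have "p \<noteq> {}" using repair data by (auto simp: LP1_data_def)
      thus ?thesis using repair by auto
    qed
  qed
  hence "independent_set ?G {v \<in> verts ?G. ?f v > 0}"
    unfolding independent_set_def by fastforce
  ultimately show ?thesis by (simp add: indep_roman_dom_fun_def)
qed

text \<open>Every block weighs \<open>2 * (k + 1)\<close>, wherever the labels sit, except that a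
  middle block falls short by 2. The deficit stands on the left to avoid truncated
  subtraction.\<close>

lemma weight_triple_label:
  assumes "finite Ts" and disj: "X \<inter> M = {}" "X \<inter> Z = {}" "M \<inter> Z = {}" and M: "M \<subseteq> {..<l}"
  shows "weight (snark_graph l c Ts Ps) (triple_label k X M Z) + 2 * card M
       = 2 * (k + 1) * l + (k + 1) * card Ts"
proof -
  let ?f = "triple_label k X M Z"
  have block: "sum ?f (block_verts i) + (if i \<in> M then 2 else 0) = 2 * (k + 1)" for i
    using disj by (auto simp: block_verts_def)
  have "sum ?f (\<Union>i<l. block_verts i) = (\<Sum>i<l. sum ?f (block_verts i))"
    by (rule sum.UNION_disjoint) (auto simp: block_verts_def)
  moreover have "(\<Sum>i<l. if i \<in> M then 2 else 0) = 2 * card M"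
    using M by (simp add: sum.If_cases Int_absorb1)
  ultimately have "sum ?f (\<Union>i<l. block_verts i) + 2 * card M = (\<Sum>i<l. 2 * (k + 1))"
    using sum.distrib[of "\<lambda>i. sum ?f (block_verts i)" "\<lambda>i. if i \<in> M then 2 else 0" "{..<l}"]
    by (simp add: block)
  moreover have "sum ?f (Link ` Ts) = (k + 1) * card Ts"
    by (subst sum.reindex) (auto simp: inj_on_def)
  moreover have "weight (snark_graph l c Ts Ps) ?f
      = sum ?f (\<Union>i<l. block_verts i) + sum ?f (Link ` Ts)"
    unfolding weight_def snark_graph_def ugraph.simps
    by (rule sum.union_disjoint) (use assms(1) in \<open>auto simp: block_verts_def\<close>)
  ultimately show ?thesis by (simp add: mult.commute)
qed

section \<open>Index sets of the linked triples, and the bound\<close>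

theorem theorem5p2:
  fixes k l \<sigma> :: nat and G :: "'a ugraph"
  assumes "k \<ge> 1" and "l \<ge> 3" and "odd l" and "\<sigma> \<ge> 1"
    and "LP0_snark l \<sigma> G"
  shows "indep_roman_dom_number k G \<le> 2 * (k + 1) * l + (k - 1) * \<sigma>"
proof -
  obtain c Ts Ps \<phi> where data: "LP0_data l Ts Ps" and \<sigma>: "card Ts = \<sigma>"
    and iso: "ugraph_iso \<phi> (snark_graph l c Ts Ps) G"
    using assms(5) by (auto simp: LP0_snark_def)
  let ?next = "\<lambda>d i. (i + d) mod l"
  have LP1: "LP1_data l Ts Ps" using data by (simp add: LP0_data_def)
  have finTs: "finite Ts" using \<sigma> assms(4) card.infinite[of Ts] by auto
  \<comment> \<open>The first index of a triple need not be unique (for \<open>l = 3\<close> each of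
    its elements qualifies), so one is chosen for each triple.\<close>
  obtain a where a: "\<And>t. t \<in> Ts \<Longrightarrow> t = {a t, ?next 1 (a t), ?next 2 (a t)}"
    using data unfolding LP0_data_def by metis
  have card3: "card t = 3" if "t \<in> Ts" for t using LP1 that by (simp add: LP1_data_def)
  have dist: "a t \<noteq> ?next 1 (a t)" "a t \<noteq> ?next 2 (a t)" "?next 1 (a t) \<noteq> ?next 2 (a t)"
    if "t \<in> Ts" for t
  proof -
    have "card {a t, ?next 1 (a t), ?next 2 (a t)} = 3" using a[OF that] card3[OF that] by metis
    thus "a t \<noteq> ?next 1 (a t)" "a t \<noteq> ?next 2 (a t)" "?next 1 (a t) \<noteq> ?next 2 (a t)"
      by (auto simp: card_insert_if split: if_splits)
  qed
  have in_t: "a t \<in> t" "?next 1 (a t) \<in> t" "?next 2 (a t) \<in> t" if "t \<in> Ts" for t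
    using a[OF that] by blast+
  have same: "t = t'" if "t \<in> Ts" "t' \<in> Ts" "x \<in> t" "x \<in> t'" for t t' x
    using LP1 that by (auto simp: LP1_data_def disjoint_def)
  define X where "X = a ` Ts"
  define M where "M = ?next 1 ` X"
  define Z where "Z = ?next 2 ` X"
  have disj: "X \<inter> M = {}" "X \<inter> Z = {}" "M \<inter> Z = {}"
  proof -
    \<comment> \<open>A common value of two selectors lies in both triples, so by disjointness these
      coincide; but within one triple the selected indices differ.\<close>
    have sep: "u ` Ts \<inter> w ` Ts = {}"
      if "\<And>t. t \<in> Ts \<Longrightarrow> u t \<in> t" "\<And>t. t \<in> Ts \<Longrightarrow> w t \<in> t" "\<And>t. t \<in> Ts \<Longrightarrow> u t \<noteq> w t" for u w
    proof -
      have "u t \<noteq> w t'" if t: "t \<in> Ts" "t' \<in> Ts" for t t'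
      proof
        assume eq: "u t = w t'"
        hence "u t \<in> t'" using t \<open>\<And>t. t \<in> Ts \<Longrightarrow> w t \<in> t\<close> by simp
        hence "t = t'" using same t \<open>\<And>t. t \<in> Ts \<Longrightarrow> u t \<in> t\<close> by blast
        thus False using eq t \<open>\<And>t. t \<in> Ts \<Longrightarrow> u t \<noteq> w t\<close> by blast
      qed
      thus ?thesis by blast
    qed
    show "X \<inter> M = {}" "X \<inter> Z = {}" "M \<inter> Z = {}"
      unfolding X_def M_def Z_def image_image
      by (rule sep[OF in_t(1,2) dist(1)] sep[OF in_t(1,3) dist(2)] sep[OF in_t(2,3) dist(3)]; assumption)+
  qed
  have linked: "X \<union> M \<union> Z = \<Union>Ts"
    using a by (fastforce simp: X_def M_def Z_def)
  have Z: "?next 1 i \<in> Z" if "i \<in> M" for i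
    using that by (auto simp: M_def Z_def mod_simps)
  have "M \<subseteq> {..<l}" using assms(2) by (auto simp: M_def)
  moreover have "card M = \<sigma>"
  proof -
    \<comment> \<open>Disjoint triples have different middle indices, so \<open>M\<close> has one
      element per triple.\<close>
    have "inj_on (\<lambda>t. ?next 1 (a t)) Ts" by (rule inj_onI) (metis same in_t(2))
    thus ?thesis using \<sigma> by (simp add: M_def X_def image_image card_image)
  qed
  ultimately have "weight (snark_graph l c Ts Ps) (triple_label k X M Z) + 2 * \<sigma>
      = 2 * (k + 1) * l + (k + 1) * \<sigma>"
    using weight_triple_label[OF finTs disj] \<sigma> by simp
  \<comment> \<open>Here \<open>k \<ge> 1\<close> keeps \<open>k - 1\<close> from being
    truncated.\<close>
  moreover have "(k + 1) * \<sigma> = (k - 1) * \<sigma> + 2 * \<sigma>"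
    using assms(1) by (simp flip: distrib_right)
  ultimately have "weight (snark_graph l c Ts Ps) (triple_label k X M Z)
      = 2 * (k + 1) * l + (k - 1) * \<sigma>" by linarith
  thus ?thesis
    using indep_roman_dom_number_le_iso[OF iso snark_graph_edge_subset[OF LP1]
        triple_label_indep_roman_dom_fun[OF assms(1) LP1 disj linked M_def Z]] by simp
qed

end
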